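(* Consider the system $$\dot x=y,\qquad \dot y=f(\boldsymbol{\omega}t)-\gamma y-x^{2p},$$ with $p\in\mathbb{N}$ and $\gamma>0$, and let $f,F>0$ be constants such that $f^{2p}\le f(\boldsymbol{\omega}t)\le F^{2p}$ for all $t$. Put $$\lambda_1=\frac{\gamma}{4pF^{2p-1}}\left[1+\sqrt{1-\frac{8pF^{2p-1}}{\gamma^2}}\right],\qquad \lambda_2=\frac{\gamma}{2p(2f)^{2p-1}}.$$ Define $\mathcal{A}$ as the hexagonal set whose vertices are G, H, I, J, K and L, where $$G=(-f,\lambda_1F^{2p}),\quad H=(0,\lambda_1F^{2p}),\quad I=(F,0),$$ $$J=(F,-\lambda_2f^{2p}(4^p-1)),\quad K=(0,-\lambda_2f^{2p}(4^p-1)),\quad L=(-f,0).$$ Let the edges LG, GH, IJ and JK of $\mathcal{A}$ be straight lines and let HI be given by $y=\lambda_1(F^{2p}-x^{2p})$ and KL by $y=\lambda_2(f^{2p}-(x+2f)^{2p})$. Then, provided that $$\gamma^2\ge\max\left(8pF^{2p-1},\ \frac{p\,(F^{2p}-f^{2p})}{f\,(1-4^{-p})}\right),$$ the set $\mathcal{A}$ is an invariant set containing the limit cycle described by the solution $x_0(t)$ in the plane $(x,y)$.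
   Context: The symbol $f$ without argument is a constant, distinct from the forcing $t\mapsto f(\boldsymbol{\omega}t)$. The forcing is $f(\boldsymbol{\psi})=\sum_{\boldsymbol{\nu}\in\mathbb{Z}^d}e^{i\boldsymbol{\nu}\cdot\boldsymbol{\psi}}f_{\boldsymbol{\nu}}$, real-valued and analytic (the coefficients $f_{\boldsymbol\nu}$ decay exponentially in $|\boldsymbol\nu|=|\nu_1|+\dots+|\nu_d|$), with average $f_{\boldsymbol 0}>0$, and $\boldsymbol{\omega}\in\mathbb{R}^d$ satisfies $|\boldsymbol{\omega}\cdot\boldsymbol{\nu}|\ge C_0|\boldsymbol{\nu}|^{-\tau}$ for all $\boldsymbol{\nu}\in\mathbb{Z}^d\setminus\{\boldsymbol 0\}$, with $C_0>0$ small enough and $\tau>d-1$. $\mathcal{A}$ is the closed region bounded by the closed curve GHIJKL. "Invariant" means positively invariant: trajectories starting in $\mathcal{A}$ (at any time) remain in $\mathcal{A}$ for all later times. $x_0(t)$ is the quasi-periodic solution of $\ddot x+\gamma\dot x+x^{2p}=f(\boldsymbol{\omega}t)$ with the same frequency vector $\boldsymbol{\omega}$ as the forcing, which exists for $\gamma$ large enough and satisfies $x_0(t)=c_0+O(1/\gamma)$, $c_0=f_{\boldsymbol 0}^{1/2p}>0$; the limit cycle is the orbit $(x_0(t),\dot x_0(t))$. *)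

theory Defs
  imports "HOL-Analysis.Analysis"
begin

section \<open>The forcing\<close>

definition phase :: "int^'d \<Rightarrow> real^'d \<Rightarrow> real" where
  "phase \<nu> \<psi> = (\<Sum>i\<in>UNIV. real_of_int (\<nu> $ i) * \<psi> $ i)"

definition l1_norm :: "int^'d \<Rightarrow> real" where
  "l1_norm \<nu> = (\<Sum>i\<in>UNIV. \<bar>real_of_int (\<nu> $ i)\<bar>)"

definition analytic_forcing :: "(int^'d \<Rightarrow> complex) \<Rightarrow> (real^'d \<Rightarrow> real) \<Rightarrow> bool" where
  "analytic_forcing fc g \<longleftrightarrow>
     (\<exists>\<Phi> \<xi>. \<xi> > 0 \<and> (\<forall>\<nu>. norm (fc \<nu>) \<le> \<Phi> * exp (- \<xi> * l1_norm \<nu>))) \<and>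
     (\<forall>\<psi>. ((\<lambda>\<nu>. cis (phase \<nu> \<psi>) * fc \<nu>) has_sum complex_of_real (g \<psi>)) UNIV)"

definition diophantine :: "real \<Rightarrow> real \<Rightarrow> real^'d \<Rightarrow> bool" where
  "diophantine C0 \<tau> \<omega> \<longleftrightarrow>
     C0 > 0 \<and> \<tau> > real CARD('d) - 1 \<and>
     (\<forall>\<nu>. \<nu> \<noteq> 0 \<longrightarrow> \<bar>phase \<nu> \<omega>\<bar> \<ge> C0 * l1_norm \<nu> powr (- \<tau>))"


section \<open>The dynamical system\<close>

text \<open>Here \<open>h\<close> is the time-dependent forcing.\<close>

definition trajectory ::
  "(real \<Rightarrow> real) \<Rightarrow> nat \<Rightarrow> real \<Rightarrow> real set \<Rightarrow> (real \<Rightarrow> real) \<Rightarrow> (real \<Rightarrow> real) \<Rightarrow> bool" where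
  "trajectory h p \<gamma> T x y \<longleftrightarrow>
     (\<forall>t\<in>T. (x has_real_derivative y t) (at t within T) \<and>
            (y has_real_derivative (h t - \<gamma> * y t - x t ^ (2 * p))) (at t within T))"

text \<open>The system is not autonomous, so the initial time \<open>t0\<close> is arbitrary; the time interval
  \<open>{t0..t1}\<close> is any on which the trajectory exists.\<close>

definition positively_invariant ::
  "(real \<Rightarrow> real) \<Rightarrow> nat \<Rightarrow> real \<Rightarrow> (real \<times> real) set \<Rightarrow> bool" where
  "positively_invariant h p \<gamma> A \<longleftrightarrow>
     (\<forall>t0 t1 x y. t0 \<le> t1 \<and> trajectory h p \<gamma> {t0..t1} x y \<and> (x t0, y t0) \<in> A \<longrightarrow>
        (\<forall>t\<in>{t0..t1}. (x t, y t) \<in> A))"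

definition quasi_periodic :: "real^'d \<Rightarrow> (real \<Rightarrow> real) \<Rightarrow> bool" where
  "quasi_periodic \<omega> x \<longleftrightarrow>
     (\<exists>X :: real^'d \<Rightarrow> real. continuous_on UNIV X \<and>
        (\<forall>\<psi> i. X (\<psi> + (2 * pi) *\<^sub>R axis i 1) = X \<psi>) \<and> (\<forall>t. x t = X (t *\<^sub>R \<omega>)))"

text \<open>\<open>x0 \<gamma>\<close>, for \<open>\<gamma> \<ge> \<gamma>0\<close>, is the quasi-periodic solution \<open>c0 + O(1/\<gamma>)\<close>. At a given finite
  \<open>\<gamma>\<close> the symbol \<open>O(1/\<gamma>)\<close> alone would not tell it apart from the unstable quasi-periodic solution
  close to \<open>- c0\<close>; \<open>B / \<gamma>0 < c0\<close> says that the threshold \<open>\<gamma>0\<close> is large enough for the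
  correction to stay below the leading term. Increasing \<open>\<gamma>0\<close> always achieves this.\<close>

definition response_family ::
  "(real^'d \<Rightarrow> real) \<Rightarrow> real^'d \<Rightarrow> nat \<Rightarrow> real \<Rightarrow> real \<Rightarrow> (real \<Rightarrow> real \<Rightarrow> real) \<Rightarrow> bool" where
  "response_family g \<omega> p c0 \<gamma>0 x0 \<longleftrightarrow>
     \<gamma>0 > 0 \<and>
     (\<forall>\<gamma>\<ge>\<gamma>0. quasi_periodic \<omega> (x0 \<gamma>) \<and>
        trajectory (\<lambda>t. g (t *\<^sub>R \<omega>)) p \<gamma> UNIV (x0 \<gamma>) (deriv (x0 \<gamma>))) \<and>
     (\<exists>B. B / \<gamma>0 < c0 \<and> (\<forall>\<gamma>\<ge>\<gamma>0. \<forall>t. \<bar>x0 \<gamma> t - c0\<bar> \<le> B / \<gamma>))"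

definition orbit :: "(real \<Rightarrow> real) \<Rightarrow> (real \<times> real) set" where
  "orbit x = range (\<lambda>t. (x t, deriv x t))"


section \<open>The hexagonal set\<close>

definition lambda1 :: "nat \<Rightarrow> real \<Rightarrow> real \<Rightarrow> real" where
  "lambda1 p \<gamma> F = \<gamma> / (4 * real p * F ^ (2 * p - 1)) *
     (1 + sqrt (1 - 8 * real p * F ^ (2 * p - 1) / \<gamma>\<^sup>2))"

definition lambda2 :: "nat \<Rightarrow> real \<Rightarrow> real \<Rightarrow> real" where
  "lambda2 p \<gamma> f = \<gamma> / (2 * real p * (2 * f) ^ (2 * p - 1))"

definition hexagon_boundary :: "nat \<Rightarrow> real \<Rightarrow> real \<Rightarrow> real \<Rightarrow> (real \<times> real) set" where
  "hexagon_boundary p \<gamma> f F =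
    (let l1 = lambda1 p \<gamma> F; l2 = lambda2 p \<gamma> f;
         G = (- f, l1 * F ^ (2 * p)); H = (0, l1 * F ^ (2 * p)); I = (F, 0);
         J = (F, - l2 * f ^ (2 * p) * (4 ^ p - 1)); K = (0, - l2 * f ^ (2 * p) * (4 ^ p - 1));
         L = (- f, 0);
         HI = (\<lambda>x. (x, l1 * (F ^ (2 * p) - x ^ (2 * p)))) ` {0..F};
         KL = (\<lambda>x. (x, l2 * (f ^ (2 * p) - (x + 2 * f) ^ (2 * p)))) ` {- f..0}
     in closed_segment L G \<union> closed_segment G H \<union> HI \<union>
        closed_segment I J \<union> closed_segment J K \<union> KL)"

text \<open>The closed region bounded by the closed curve: \<open>inside C\<close> is the union of the bounded
  components of the complement of \<open>C\<close>.\<close>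

definition hexagon :: "nat \<Rightarrow> real \<Rightarrow> real \<Rightarrow> real \<Rightarrow> (real \<times> real) set" where
  "hexagon p \<gamma> f F = hexagon_boundary p \<gamma> f F \<union> inside (hexagon_boundary p \<gamma> f F)"

end

theory Submission
  imports Defs
begin

text \<open>
  Write \<open>n = 2 * p\<close>. The hexagon is the set of points \<open>(x, y)\<close> with \<open>- f \<le> x \<le> F\<close> that lie between
  two graphs, and on every edge the vector field points weakly inward for every value of the
  forcing in \<open>{f ^ n..F ^ n}\<close>. The constants are chosen for exactly that. The number \<open>\<lambda>\<^sub>1\<close> is the larger
  root of \<open>n F ^ (n - 1) \<lambda>\<^sup>2 - \<gamma> \<lambda> + 1\<close>, so that along the edge HI the rate of \<open>y - \<lambda>\<^sub>1 (F ^ n - x ^ n)\<close>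
  is at most \<open>(F ^ n - x ^ n) (1 + \<lambda>\<^sub>1 (\<lambda>\<^sub>1 n F ^ (n - 1) - \<gamma>)) = 0\<close>. The number \<open>\<lambda>\<^sub>2\<close> makes the slope
  of the edge KL reach \<open>- \<gamma>\<close> exactly at the vertex K. The second lower bound for \<open>\<gamma>\<^sup>2\<close> says that
  \<open>f ^ n - F ^ n - \<gamma> y \<ge> 0\<close> on the edge JK.

  Weak inwardness alone does not give invariance: when the forcing equals \<open>f ^ n\<close>, the vertex L is
  a saddle, and a trajectory is kept from leaving there only by the Lipschitz property of the field.
  This property is used as follows. Suppose that the largest violation \<open>e\<close> among the constraints that
  define the region is positive and at most \<open>f\<close>; then it grows at a rate at most \<open>K e\<close>. By
  \<open>invariance_of_smooth_constraints\<close> the violations cannot overtake the barrier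
  \<open>\<epsilon> exp ((K + 1) t)\<close> for any small \<open>\<epsilon>\<close>, so none of them becomes positive. Only constraints that
  are the most violated ones have to be controlled, which is what makes the corners harmless: when
  \<open>x\<close> is left of \<open>- f\<close> by the amount \<open>e\<close>, the velocity is known to be at least \<open>- e\<close>, and
  similarly to the right of \<open>F\<close>.

  The solution \<open>x\<^sub>0\<close> is positive and bounded for all times, past and future, and no such solution
  is ever outside the hexagon (\<open>bounded_nonneg_solution_in_region\<close>). Outside the hexagon, a violation of \<open>y \<ge> bottom\<close> or of the
  upper edge does not decrease when followed back in time, so \<open>y\<close> would stay away from \<open>0\<close> with a
  fixed sign in the whole past and \<open>x\<close> would be unbounded. If \<open>x > F\<close> at some time, then \<open>x > F\<close> and
  \<open>y \<le> 0\<close> in the whole past, and now \<open>\<gamma> x + y\<close>, whose derivative is the forcing minus \<open>x ^ n\<close>,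
  would be unbounded above.
\<close>

section \<open>Smooth constraints along a trajectory\<close>

text \<open>Each pair in \<open>P\<close> is a constraint \<open>v \<le> 0\<close> together with its time derivative. The values are
  compared with \<open>E t = \<epsilon> exp (L t)\<close>, \<open>L > K\<close>: at the first time when some \<open>v\<close> touches \<open>E\<close> it is
  a largest one, so it grows at a rate at most \<open>K E < L E\<close>, which means that \<open>v\<close> was above \<open>E\<close>
  just before. The growth bound is needed only for the largest value and only below \<open>\<delta>\<close>, because
  \<open>\<epsilon>\<close> may be as small as desired.\<close>

lemma invariance_of_smooth_constraints:
  fixes P :: "((real \<Rightarrow> real) \<times> (real \<Rightarrow> real)) set" and a b \<delta> K :: real
  assumes fin: "finite P"
    and deriv: "\<And>v v' t. (v, v') \<in> P \<Longrightarrow> t \<in> {a..b} \<Longrightarrow>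
      (v has_real_derivative v' t) (at t within {a..b})"
    and init: "\<And>v v'. (v, v') \<in> P \<Longrightarrow> v a \<le> 0"
    and \<delta>: "\<delta> > 0"
    and growth: "\<And>v v' t. (v, v') \<in> P \<Longrightarrow> t \<in> {a..b} \<Longrightarrow> 0 < v t \<Longrightarrow> v t \<le> \<delta> \<Longrightarrow>
      (\<forall>(w, w') \<in> P. w t \<le> v t) \<Longrightarrow> v' t \<le> K * v t"
    and mem: "(u, u') \<in> P" and s: "s \<in> {a..b}"
  shows "u s \<le> 0"
proof (rule ccontr)
  assume "\<not> u s \<le> 0"
  hence us: "u s > 0" by simp
  \<comment> \<open>The barrier ends at a value not above \<open>u s\<close>, so that \<open>u\<close> has to touch it, and it never
    exceeds \<open>\<delta>\<close>.\<close>
  define L where "L = max K 0 + 1"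
  define m where "m = min \<delta> (u s)"
  define E where "E = (\<lambda>t. m * exp (L * (t - b)))"
  have m0: "m > 0" using \<delta> us by (simp add: m_def)
  have L0: "L > 0" by (simp add: L_def)
  have E0: "E t > 0" for t using m0 by (simp add: E_def)
  have Em: "E t \<le> m" if "t \<le> b" for t
    using that m0 L0 by (simp add: E_def mult_le_0_iff)
  have dE: "(E has_real_derivative L * E t) (at t within S)" for t S
    unfolding E_def by (auto intro!: derivative_eq_intros)
  have cont: "continuous_on {a..b} (\<lambda>t. v t - E t)" if "(v, v') \<in> P" for v v'
    using deriv[OF that] dE
    by (intro continuous_on_diff) (meson DERIV_continuous continuous_on_eq_continuous_within)+
  define Z where "Z = (\<Union>q\<in>P. {t \<in> {a..b}. 0 \<le> fst q t - E t})"
  have "closed {t \<in> {a..b}. 0 \<le> fst q t - E t}" if "q \<in> P" for q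
    using continuous_on_closed_Collect_le[OF continuous_on_const cont[of "fst q" "snd q"], of 0] that
    by simp
  hence "closed Z" unfolding Z_def using fin by (intro closed_UN) auto
  moreover have "Z \<subseteq> {a..b}" by (auto simp: Z_def)
  ultimately have "compact Z"
    by (meson bounded_closed_interval bounded_subset compact_eq_bounded_closed)
  moreover have "s \<in> Z"
    using mem s Em[of s] by (force simp: Z_def m_def intro!: bexI[of _ "(u, u')"])
  ultimately obtain r where r: "r \<in> Z" and r_le: "\<And>t. t \<in> Z \<Longrightarrow> r \<le> t"
    using compact_attains_inf[of Z] by blast
  then obtain v v' where v: "(v, v') \<in> P" and rab: "r \<in> {a..b}" and vr: "E r \<le> v r"
    by (auto simp: Z_def)
  have before: "w t < E t" if "(w, w') \<in> P" "t \<in> {a..b}" "t < r" for w w' t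
    using r_le[of t] that by (force simp: Z_def)
  \<comment> \<open>No constraint jumps over the barrier, so the touching one is the largest.\<close>
  have at_r: "w r \<le> E r" if w: "(w, w') \<in> P" for w w'
  proof (rule ccontr)
    assume c: "\<not> w r \<le> E r"
    have "w a - E a \<le> 0" using init[OF w] E0[of a] by linarith
    then obtain q where q: "a \<le> q" "q \<le> r" "w q - E q = 0"
      using IVT'[of "\<lambda>t. w t - E t" a 0 r] c rab continuous_on_subset[OF cont[OF w], of "{a..r}"]
      by auto
    with c have "q < r" by (cases "q = r") auto
    with before[OF w, of q] q rab show False by auto
  qed
  have vE: "v r = E r" using at_r[OF v] vr by simp
  have "v' r \<le> K * E r"
    using growth[OF v rab] at_r E0[of r] Em[of r] rab unfolding vE by (auto simp: m_def)
  also have "\<dots> < L * E r" using E0[of r] by (intro mult_strict_right_mono) (auto simp: L_def)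
  finally have neg: "v' r - L * E r < 0" by simp
  have "a < r"
    using init[OF v] vr E0[of r] rab by (cases "a = r") auto
  obtain d where d: "d > 0" "\<And>h. h > 0 \<Longrightarrow> r - h \<in> {a..b} \<Longrightarrow> h < d \<Longrightarrow> v r - E r < v (r - h) - E (r - h)"
    using has_real_derivative_neg_dec_left[OF DERIV_diff[OF deriv[OF v rab] dE] neg] by blast
  define h where "h = min (d / 2) (r - a)"
  have "h > 0" "h < d" "r - h \<in> {a..b}" using d(1) \<open>a < r\<close> rab by (auto simp: h_def)
  with d(2)[of h] before[OF v, of "r - h"] vE show False by simp
qed

section \<open>Following a solution back in time\<close>

lemma last_crossing:
  fixes w :: "real \<Rightarrow> real"
  assumes cont: "continuous_on {a..b} w" and "a \<le> b" "w a \<le> c" "c < w b"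
  obtains r where "a \<le> r" "r < b" "w r = c" "\<And>t. r < t \<Longrightarrow> t \<le> b \<Longrightarrow> c < w t"
proof -
  define Z where "Z = {t \<in> {a..b}. w t \<le> c}"
  have "closed Z"
    unfolding Z_def by (intro continuous_on_closed_Collect_le cont continuous_on_const closed_atLeastAtMost)
  moreover have "Z \<subseteq> {a..b}" by (auto simp: Z_def)
  ultimately have "compact Z"
    by (meson bounded_closed_interval bounded_subset compact_eq_bounded_closed)
  moreover have "a \<in> Z" using assms by (auto simp: Z_def)
  ultimately obtain r where r: "r \<in> Z" and r_ge: "\<And>t. t \<in> Z \<Longrightarrow> t \<le> r"
    using compact_attains_sup[of Z] by blast
  have rab: "a \<le> r" "r \<le> b" "w r \<le> c" using r by (auto simp: Z_def)
  obtain q where q: "r \<le> q" "q \<le> b" "w q = c"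
    using IVT'[of w r c b] rab assms(4) continuous_on_subset[OF cont, of "{r..b}"] by auto
  hence "q = r" using r_ge[of q] rab by (auto simp: Z_def)
  moreover have "r < b" using rab assms(4) by (cases "r = b") auto
  moreover have "c < w t" if "r < t" "t \<le> b" for t
    using r_ge[of t] that rab by (force simp: Z_def)
  ultimately show ?thesis using that[of r] rab q by blast
qed

text \<open>The sign of the derivative is required only where \<open>w > c\<close>. This is enough because the end
  value exceeds \<open>c\<close>: if \<open>w\<close> started lower, it would have to increase after its last visit to the
  higher one of the levels \<open>w a\<close> and \<open>c\<close>. It shows that a violation present now was at least as
  large in the past.\<close>

lemma nonincreasing_above_level:
  fixes w w' :: "real \<Rightarrow> real"
  assumes "a \<le> b"
    and deriv: "\<And>t. (w has_real_derivative w' t) (at t)"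
    and sign: "\<And>t. a \<le> t \<Longrightarrow> t \<le> b \<Longrightarrow> w t > c \<Longrightarrow> w' t \<le> 0"
    and "w b > c"
  shows "w b \<le> w a"
proof (rule ccontr)
  assume "\<not> w b \<le> w a"
  define e where "e = max (w a) c"
  have e: "w a \<le> e" "c \<le> e" "e < w b" using \<open>\<not> w b \<le> w a\<close> assms(4) by (auto simp: e_def)
  have "continuous_on {a..b} w"
    using deriv by (auto intro!: continuous_at_imp_continuous_on DERIV_isCont)
  then obtain r where r: "a \<le> r" "r < b" "w r = e" "\<And>t. r < t \<Longrightarrow> t \<le> b \<Longrightarrow> e < w t"
    using last_crossing[of a b w e] e \<open>a \<le> b\<close> by blast
  obtain z where z: "r < z" "z < b" "w b - w r = (b - r) * w' z"
    using MVT2[of r b w w'] deriv r by blast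
  have "w' z \<le> 0" using sign[of z] r(4)[of z] z r(1) e by simp
  hence "w b \<le> w r" using z r mult_nonneg_nonpos[of "b - r" "w' z"] by simp
  with r e show False by simp
qed

lemma no_uniform_slope_if_bounded_below:
  fixes z z' :: "real \<Rightarrow> real"
  assumes deriv: "\<And>t. (z has_real_derivative z' t) (at t)"
    and slope: "\<And>t. t \<le> T \<Longrightarrow> d \<le> z' t" and "d > 0"
    and bound: "\<And>t. t \<le> T \<Longrightarrow> B \<le> z t"
  shows False
proof -
  \<comment> \<open>Going back from \<open>T\<close> to \<open>a\<close>, the value \<open>z\<close> drops by at least \<open>\<bar>z T - B\<bar> + d\<close>.\<close>
  define a where "a = T - (\<bar>z T - B\<bar> / d + 1)"
  have "0 \<le> \<bar>z T - B\<bar> / d" using \<open>d > 0\<close> by simp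
  hence "a < T" unfolding a_def by linarith
  then obtain q where q: "a < q" "q < T" "z T - z a = (T - a) * z' q"
    using MVT2[of a T z z'] deriv by blast
  have "(T - a) * d \<le> (T - a) * z' q" using slope[of q] q by (intro mult_left_mono) auto
  moreover have "(T - a) * d = \<bar>z T - B\<bar> + d" using \<open>d > 0\<close> by (simp add: a_def field_simps)
  ultimately show False using q bound[of a] \<open>a < T\<close> \<open>d > 0\<close> by linarith
qed

section \<open>Powers\<close>

lemma max_power_has_derivative:
  assumes "m \<ge> 2"
  shows "((\<lambda>x::real. max x 0 ^ m) has_real_derivative real m * max x 0 ^ (m - 1)) (at x)"
proof (cases x "0::real" rule: linorder_cases)
  case less
  have "((\<lambda>_. 0::real) has_real_derivative 0) (at x)" by simp
  then show ?thesis
    using less assms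
    by (subst DERIV_cong_ev[OF refl _ refl, of _ "\<lambda>_. 0"])
       (auto intro!: eventually_mono[OF eventually_nhds_in_open[of "{..<0}"]]
         simp: max_def power_0_left)
next
  case greater
  have "((\<lambda>x. x ^ m) has_real_derivative real m * x ^ (m - 1)) (at x)"
    using DERIV_pow[of m x] by simp
  then show ?thesis
    using greater
    by (subst DERIV_cong_ev[OF refl _ refl, of _ "\<lambda>x. x ^ m"])
       (auto intro!: eventually_mono[OF eventually_nhds_in_open[of "{0<..}"]] simp: max_def)
next
  case equal
  have "((\<lambda>h::real. max h 0 ^ (m - 1)) \<longlongrightarrow> max 0 0 ^ (m - 1)) (at 0)"
    by (intro tendsto_intros)
  moreover have "max 0 0 ^ (m - 1) = (0::real)" using assms by simp
  ultimately have "((\<lambda>h::real. max h 0 ^ (m - 1)) \<longlongrightarrow> 0) (at 0)" by (simp only:)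
  moreover have "\<forall>\<^sub>F h::real in at 0. max h 0 ^ (m - 1) = max h 0 ^ m / h"
    unfolding eventually_at using assms
    by (intro exI[of _ 1]) (auto simp: max_def field_simps power_eq_if[of _ m])
  ultimately have "((\<lambda>h::real. max h 0 ^ m / h) \<longlongrightarrow> 0) (at 0)"
    by (rule Lim_transform_eventually)
  moreover have "max 0 0 ^ m = (0::real)" "max 0 0 ^ (m - 1) = (0::real)" using assms by auto
  ultimately show ?thesis by (simp only: DERIV_def equal add_0 diff_zero mult_zero_right)
qed

lemma power_diff_le_deriv:
  fixes a b :: real
  assumes "0 \<le> a" "a \<le> b"
  shows "b ^ m - a ^ m \<le> real m * b ^ (m - 1) * (b - a)"
proof (cases "a = b")
  case False
  with assms obtain z where z: "a < z" "z < b" "b ^ m - a ^ m = (b - a) * (real m * z ^ (m - 1))"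
    using MVT2[of a b "\<lambda>x. x ^ m" "\<lambda>x. real m * x ^ (m - 1)"] DERIV_pow[of m] by force
  have "z ^ (m - 1) \<le> b ^ (m - 1)" using z assms by (intro power_mono) auto
  hence "(b - a) * (real m * z ^ (m - 1)) \<le> (b - a) * (real m * b ^ (m - 1))"
    using assms by (intro mult_left_mono) auto
  with z show ?thesis by (simp add: mult_ac)
qed simp

section \<open>The closed region bounded by two graphs\<close>

text \<open>A connected set that avoids the boundary curve \<open>C\<close> cannot leave the open region \<open>D\<close>, because the
  frontier of \<open>D\<close> is part of \<open>C\<close>; hence the points of \<open>D\<close> lie inside. From a point that does not
  belong to \<open>A\<close> a vertical ray, upward or downward, escapes to infinity without meeting \<open>C\<close>.\<close>

lemma region_between_graphs:
  fixes lo up :: "real \<Rightarrow> real" and a b :: real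
  assumes lo: "continuous_on UNIV lo" and up: "continuous_on UNIV up"
  defines "A \<equiv> {(x, y). a \<le> x \<and> x \<le> b \<and> lo x \<le> y \<and> y \<le> up x}"
  defines "C \<equiv> {(x, y). a \<le> x \<and> x \<le> b \<and> lo x \<le> y \<and> y \<le> up x \<and> (x = a \<or> x = b \<or> y = lo x \<or> y = up x)}"
  shows "C \<union> inside C = A"
proof
  define D where "D = {(x, y). a < x \<and> x < b \<and> lo x < y \<and> y < up x}"
  note [continuous_intros] = continuous_on_compose2[OF lo] continuous_on_compose2[OF up]
  have D: "open D"
    unfolding D_def case_prod_unfold
    by (intro open_Collect_conj open_Collect_less continuous_intros) auto
  have "closed A"
    unfolding A_def case_prod_unfold
    by (intro closed_Collect_conj closed_Collect_le continuous_intros) auto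
  moreover have "D \<subseteq> A" by (auto simp: D_def A_def)
  ultimately have "closure D \<subseteq> A" by (simp add: closure_minimal)
  moreover have "A - D \<subseteq> C" by (auto simp: A_def C_def D_def)
  ultimately have fr: "frontier D \<subseteq> C" using D by (auto simp: frontier_def interior_open)
  have "bounded A"
  proof -
    obtain M where M: "\<forall>x\<in>{a..b}. norm (lo x) \<le> M"
      using compact_imp_bounded[OF compact_continuous_image[OF continuous_on_subset[OF lo] compact_Icc, of a b]]
      by (auto simp: bounded_iff)
    obtain N where N: "\<forall>x\<in>{a..b}. norm (up x) \<le> N"
      using compact_imp_bounded[OF compact_continuous_image[OF continuous_on_subset[OF up] compact_Icc, of a b]]
      by (auto simp: bounded_iff)
    have "A \<subseteq> {a..b} \<times> {-M..N}" using M N by (force simp: A_def abs_le_iff)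
    thus ?thesis
      by (rule bounded_subset[OF bounded_Times[OF bounded_closed_interval bounded_closed_interval]])
  qed
  show "A \<subseteq> C \<union> inside C"
  proof
    fix q assume q: "q \<in> A"
    show "q \<in> C \<union> inside C"
    proof (cases "q \<in> C")
      case False
      with q have qD: "q \<in> D" using \<open>A - D \<subseteq> C\<close> by auto
      let ?K = "connected_component_set (- C) q"
      have "?K \<subseteq> D"
      proof (rule ccontr)
        assume "\<not> ?K \<subseteq> D"
        moreover have "q \<in> ?K" using False by simp
        hence "?K \<inter> D \<noteq> {}" using qD by blast
        ultimately have "?K \<inter> frontier D \<noteq> {}"
          by (intro connected_Int_frontier connected_connected_component) auto
        with fr connected_component_subset[of "- C" q] show False by auto
      qed
      hence "bounded ?K" using \<open>bounded A\<close> \<open>D \<subseteq> A\<close> by (meson bounded_subset)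
      with False show ?thesis by (simp add: inside_def)
    qed simp
  qed
  have ray: "\<not> bounded S" if "\<And>y. y \<in> Y \<Longrightarrow> (x, y) \<in> S" "\<not> bounded Y" for S :: "(real \<times> real) set" and x Y
  proof
    assume "bounded S"
    hence "bounded (snd ` S)" by (rule bounded_snd)
    moreover have "Y \<subseteq> snd ` S" using that(1) by force
    ultimately show False using that(2) bounded_subset by blast
  qed
  show "C \<union> inside C \<subseteq> A"
  proof
    fix q assume q: "q \<in> C \<union> inside C"
    obtain x y where xy: "q = (x, y)" by (cases q)
    show "q \<in> A"
    proof (rule ccontr)
      assume nA: "q \<notin> A"
      with q have qin: "bounded (connected_component_set (- C) q)"
        by (auto simp: C_def A_def inside_def)
      have *: False if "connected Y" "y \<in> Y" "\<not> bounded Y" "{x} \<times> Y \<subseteq> - C" for Y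
      proof -
        have "{x} \<times> Y \<subseteq> connected_component_set (- C) q"
          using that by (intro connected_component_maximal connected_Times) (auto simp: xy)
        with qin have "bounded ({x} \<times> Y)" by (rule bounded_subset)
        with ray[of Y x "{x} \<times> Y"] that show False by auto
      qed
      have "\<not> bounded {y..}" "\<not> bounded {..y}"
      proof -
        have "\<exists>z\<ge>y. \<not> \<bar>z\<bar> \<le> M" "\<exists>z\<le>y. \<not> \<bar>z\<bar> \<le> M" for M
          by (intro exI[of _ "max y (M + 1)"] exI[of _ "min y (- M - 1)"]; linarith)+
        thus "\<not> bounded {y..}" "\<not> bounded {..y}" by (auto simp: bounded_iff)
      qed
      with *[of "{y..}"] *[of "{..y}"] nA show False
        unfolding xy A_def C_def by fastforce
    qed
  qed
qed


section \<open>The hexagon and its constants\<close>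

locale bounded_forcing_oscillator =
  fixes h :: "real \<Rightarrow> real" and p :: nat and \<gamma> f F :: real
  assumes p: "p \<ge> 1" and \<gamma>: "\<gamma> > 0" and f: "f > 0" and F: "F > 0"
    and h_ge: "\<And>t. f ^ (2 * p) \<le> h t" and h_le: "\<And>t. h t \<le> F ^ (2 * p)"
    and overdamped: "8 * real p * F ^ (2 * p - 1) \<le> \<gamma>\<^sup>2"
    and floor_cond: "real p * (F ^ (2 * p) - f ^ (2 * p)) / (f * (1 - 1 / 4 ^ p)) \<le> \<gamma>\<^sup>2"
begin

definition "l1 = lambda1 p \<gamma> F"
definition "l2 = lambda2 p \<gamma> f"

text \<open>The edges GH and HI form the graph of one function. Cutting \<open>x\<close> off at \<open>0\<close> inside the power
  makes it continuously differentiable, so that the upper edge is a single smooth constraint.\<close>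

definition upper :: "real \<Rightarrow> real" where
  "upper x = l1 * (F ^ (2 * p) - max x 0 ^ (2 * p))"

text \<open>The lower boundary has a kink at the vertex K. It is convex there, so it is the maximum of
  two smooth functions and gives the two constraints \<open>lower_arc x \<le> y\<close> and \<open>bottom \<le> y\<close>.\<close>

definition lower_arc :: "real \<Rightarrow> real" where
  "lower_arc x = l2 * (f ^ (2 * p) - (x + 2 * f) ^ (2 * p))"

definition bottom :: real where
  "bottom = l2 * (f ^ (2 * p) - (2 * f) ^ (2 * p))"

definition region :: "(real \<times> real) set" where
  "region = {(x, y). - f \<le> x \<and> x \<le> F \<and> lower_arc x \<le> y \<and> bottom \<le> y \<and> y \<le> upper x}"

lemma l1_pos: "l1 > 0"
proof -
  have "8 * real p * F ^ (2 * p - 1) / \<gamma>\<^sup>2 \<le> 1" using overdamped \<gamma> by simp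
  hence "0 < 1 + sqrt (1 - 8 * real p * F ^ (2 * p - 1) / \<gamma>\<^sup>2)"
    by (intro add_pos_nonneg) auto
  moreover have "0 < \<gamma> / (4 * real p * F ^ (2 * p - 1))" using p \<gamma> F by simp
  ultimately show ?thesis unfolding l1_def lambda1_def by (rule mult_pos_pos[rotated])
qed

lemma l2_pos: "l2 > 0"
  using p \<gamma> f by (simp add: l2_def lambda2_def)

lemma f_le_F: "f \<le> F"
  using order_trans[OF h_ge h_le] p f F power_mono_iff[of f F "2 * p"] by simp

text \<open>This equation is the reason for the formula for \<open>\<lambda>\<^sub>1\<close>; the first lower bound for \<open>\<gamma>\<^sup>2\<close> says
  that the discriminant is nonnegative.\<close>

lemma l1_quadratic: "l1 * (2 * real p * F ^ (2 * p - 1) * l1 - \<gamma>) = - 1"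
proof -
  define c where "c = 2 * real p * F ^ (2 * p - 1)"
  define r where "r = sqrt (1 - 4 * c / \<gamma>\<^sup>2)"
  have c: "c > 0" using p F by (simp add: c_def)
  have "4 * c / \<gamma>\<^sup>2 \<le> 1" using overdamped \<gamma> by (simp add: c_def)
  hence r: "r\<^sup>2 = 1 - 4 * c / \<gamma>\<^sup>2" by (simp add: r_def)
  have l: "l1 = \<gamma> / (2 * c) * (1 + r)"
    by (simp add: l1_def lambda1_def r_def c_def mult.assoc)
  have "l1 * (c * l1 - \<gamma>) = \<gamma>\<^sup>2 / (4 * c) * (r\<^sup>2 - 1)"
    using c by (simp add: l field_simps power2_eq_square)
  also have "\<dots> = - 1" using c \<gamma> by (simp add: r)
  finally show ?thesis by (simp add: c_def)
qed

text \<open>The flat edge GH lies at a height at which friction outweighs the largest forcing.\<close>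

lemma l1_\<gamma>: "\<gamma> * l1 \<ge> 1"
proof -
  have "l1 * (2 * real p * F ^ (2 * p - 1) * l1) \<ge> 0" using l1_pos F by simp
  with l1_quadratic show ?thesis by (simp add: algebra_simps)
qed

text \<open>The slope of \<open>lower_arc\<close> at \<open>0\<close> is \<open>- \<gamma>\<close>.\<close>

lemma l2_\<gamma>: "l2 * (2 * real p * (2 * f) ^ (2 * p - 1)) = \<gamma>"
  using p f by (simp add: l2_def lambda2_def)

lemma two_power_double: "(2::real) ^ (2 * p) = 4 ^ p"
  by (simp add: power_mult)

text \<open>The second lower bound for \<open>\<gamma>\<^sup>2\<close> in the form in which the edge JK needs it: friction at the
  level \<open>bottom\<close> outweighs the worst force \<open>f ^ n - F ^ n\<close>.\<close>

lemma bottom_le: "\<gamma> * bottom \<le> f ^ (2 * p) - F ^ (2 * p)"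
proof -
  define q where "q = 1 - 1 / (4::real) ^ p"
  have q: "q > 0" using p by (simp add: q_def)
  have e: "\<gamma> * bottom = - (\<gamma>\<^sup>2 * (f * q) / real p)"
  proof -
    have "2 * real p * bottom * (2 * f) ^ (2 * p - 1) =
        l2 * (2 * real p * (2 * f) ^ (2 * p - 1)) * (f ^ (2 * p) - (2 * f) ^ (2 * p))"
      by (simp only: bottom_def mult_ac)
    also have "\<dots> = \<gamma> * (f ^ (2 * p) - (2 * f) ^ (2 * p))" by (simp only: l2_\<gamma>)
    also have "f ^ (2 * p) - (2 * f) ^ (2 * p) = - ((2 * f) ^ (2 * p) * q)"
      unfolding q_def power_mult_distrib two_power_double by (simp add: field_simps)
    also have "(2 * f) ^ (2 * p) = 2 * f * (2 * f) ^ (2 * p - 1)"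
      using p by (simp add: power_eq_if[of _ "2 * p"])
    finally have "(real p * bottom) * (2 * (2 * f) ^ (2 * p - 1)) = (- (\<gamma> * f * q)) * (2 * (2 * f) ^ (2 * p - 1))"
      by (simp add: mult_ac)
    hence "real p * bottom = - (\<gamma> * f * q)"
      using f by (subst (asm) mult_right_cancel) auto
    hence "bottom = - (\<gamma> * f * q) / real p"
      using p by (simp add: field_simps)
    thus ?thesis by (simp add: power2_eq_square)
  qed
  have "real p * (F ^ (2 * p) - f ^ (2 * p)) \<le> \<gamma>\<^sup>2 * (f * q)"
    using floor_cond q f by (simp add: q_def pos_divide_le_eq)
  hence "F ^ (2 * p) - f ^ (2 * p) \<le> \<gamma>\<^sup>2 * (f * q) / real p"
    using p by (simp add: field_simps)
  with e show ?thesis by simp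
qed

lemma bottom_neg: "bottom < 0"
  using p f l2_pos by (simp add: bottom_def mult_less_0_iff power_strict_mono)

lemma region_eq_hexagon: "hexagon p \<gamma> f F = region"
proof -
  \<comment> \<open>One function for the whole lower boundary, continuous on the whole line.\<close>
  define lo where "lo x = l2 * (f ^ (2 * p) - (min x 0 + 2 * f) ^ (2 * p))" for x
  have lo_neg: "lo x = lower_arc x" if "x \<le> 0" for x
    using that by (simp add: lo_def lower_arc_def min_def)
  have lo_pos: "lo x = bottom" if "x \<ge> 0" for x
    using that by (auto simp: lo_def bottom_def min_def)
  have bottom': "- l2 * f ^ (2 * p) * (4 ^ p - 1) = bottom"
    unfolding bottom_def power_mult_distrib two_power_double by (simp add: algebra_simps)
  have lo_iff: "lo x \<le> y \<longleftrightarrow> lower_arc x \<le> y \<and> bottom \<le> y" if "- f \<le> x" for x y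
  proof (cases "x \<le> 0")
    case True
    have "(x + 2 * f) ^ (2 * p) \<le> (2 * f) ^ (2 * p)"
      using that True f by (intro power_mono) auto
    hence "bottom \<le> lower_arc x" using l2_pos by (simp add: bottom_def lower_arc_def)
    with True show ?thesis by (auto simp: lo_neg)
  next
    case False
    have "(2 * f) ^ (2 * p) \<le> (x + 2 * f) ^ (2 * p)"
      using False f by (intro power_mono) auto
    hence "lower_arc x \<le> bottom" using l2_pos by (simp add: bottom_def lower_arc_def)
    with False show ?thesis by (auto simp: lo_pos)
  qed
  have up_neg: "upper x = l1 * F ^ (2 * p)" if "x \<le> 0" for x
    using that p by (simp add: upper_def max_def power_0_left)
  have up_pos: "upper x = l1 * (F ^ (2 * p) - x ^ (2 * p))" if "x \<ge> 0" for x
    using that by (simp add: upper_def)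
  have vals: "lo (- f) = 0" "upper F = 0" "upper (- f) = l1 * F ^ (2 * p)" "lo F = bottom"
    using f F by (simp_all add: lo_neg lower_arc_def up_pos up_neg lo_pos)
  have top: "l1 * F ^ (2 * p) \<ge> 0" using l1_pos F by simp
  have lo_le: "lo x \<le> 0" if "- f \<le> x" for x
  proof -
    have "f ^ (2 * p) \<le> (min x 0 + 2 * f) ^ (2 * p)"
      using that f by (intro power_mono) auto
    with l2_pos show ?thesis by (simp add: lo_def mult_le_0_iff)
  qed
  have up_ge: "0 \<le> upper x" if "x \<le> F" for x
  proof -
    have "max x 0 ^ (2 * p) \<le> F ^ (2 * p)" using that F by (intro power_mono) auto
    with l1_pos show ?thesis by (simp add: upper_def)
  qed
  let ?C = "{(x, y). - f \<le> x \<and> x \<le> F \<and> lo x \<le> y \<and> y \<le> upper x \<and>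
    (x = - f \<or> x = F \<or> y = lo x \<or> y = upper x)}"
  have "hexagon_boundary p \<gamma> f F =
      {- f} \<times> {0..l1 * F ^ (2 * p)} \<union> {- f..0} \<times> {l1 * F ^ (2 * p)} \<union>
      (\<lambda>x. (x, upper x)) ` {0..F} \<union> {F} \<times> {bottom..0} \<union> {0..F} \<times> {bottom} \<union>
      (\<lambda>x. (x, lo x)) ` {- f..0}"
    unfolding hexagon_boundary_def Let_def l1_def[symmetric] l2_def[symmetric] bottom'
    using f F top bottom_neg
    by (simp add: closed_segment_same_fst closed_segment_same_snd closed_segment_eq_real_ivl
        up_pos lo_neg lower_arc_def cong: image_cong_simp)
  also have "\<dots> = ?C"
    (is "?B = _")
  proof
    have "lo x \<le> l1 * F ^ (2 * p)" if "- f \<le> x" for x using lo_le[OF that] top by simp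
    moreover have "bottom \<le> upper x" if "x \<le> F" for x using up_ge[OF that] bottom_neg by simp
    ultimately show "?B \<subseteq> ?C"
      using f F lo_le up_ge top bottom_neg
      by (auto simp: vals up_neg lo_pos intro: order_trans[OF lo_le up_ge])
    show "?C \<subseteq> ?B"
    proof
      fix q assume "q \<in> ?C"
      then obtain x y where q: "q = (x, y)" and xy: "- f \<le> x" "x \<le> F" "lo x \<le> y" "y \<le> upper x"
        and edge: "x = - f \<or> x = F \<or> y = lo x \<or> y = upper x"
        by auto
      consider "x = - f" | "x = F" | "x \<le> 0" "y = lo x" | "x \<ge> 0" "y = lo x"
        | "x \<le> 0" "y = upper x" | "x \<ge> 0" "y = upper x"
        using edge by linarith
      then show "q \<in> ?B"
      proof cases
        case 1
        hence "(x, y) \<in> {- f} \<times> {0..l1 * F ^ (2 * p)}" using xy vals by simp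
        thus ?thesis unfolding q by blast
      next
        case 2
        hence "(x, y) \<in> {F} \<times> {bottom..0}" using xy vals by simp
        thus ?thesis unfolding q by blast
      next
        case 3
        hence "(x, y) \<in> (\<lambda>x. (x, lo x)) ` {- f..0}" using xy by simp
        thus ?thesis unfolding q by blast
      next
        case 4
        hence "(x, y) \<in> {0..F} \<times> {bottom}" using xy lo_pos by simp
        thus ?thesis unfolding q by blast
      next
        case 5
        hence "(x, y) \<in> {- f..0} \<times> {l1 * F ^ (2 * p)}" using xy up_neg by simp
        thus ?thesis unfolding q by blast
      next
        case 6
        hence "(x, y) \<in> (\<lambda>x. (x, upper x)) ` {0..F}" using xy by simp
        thus ?thesis unfolding q by blast
      qed
    qed
  qed
  finally have B: "hexagon_boundary p \<gamma> f F = ?C" .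
  have "continuous_on UNIV lo" "continuous_on UNIV upper"
    unfolding lo_def upper_def by (intro continuous_intros)+
  from region_between_graphs[OF this, of "- f" F]
  have "hexagon p \<gamma> f F = {(x, y). - f \<le> x \<and> x \<le> F \<and> lo x \<le> y \<and> y \<le> upper x}"
    unfolding hexagon_def B .
  also have "\<dots> = region" unfolding region_def using lo_iff by auto
  finally show ?thesis .
qed

section \<open>Growth of the largest violation\<close>

lemma upper_has_derivative:
  "(upper has_real_derivative - (l1 * (2 * real p * max x 0 ^ (2 * p - 1)))) (at x)"
  unfolding upper_def
  using DERIV_cmult[OF DERIV_diff[OF DERIV_const max_power_has_derivative[of "2 * p" x]], of l1 "F ^ (2 * p)"] p
  by simp

lemma lower_arc_has_derivative:
  "(lower_arc has_real_derivative - (l2 * (2 * real p * (x + 2 * f) ^ (2 * p - 1)))) (at x)"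
  unfolding lower_arc_def
  by (auto intro!: derivative_eq_intros)

text \<open>The left-hand side is the rate of \<open>y - upper x\<close> at \<open>y = upper x + e\<close>. With \<open>c\<close> the slope
  coefficient minus friction, it is at most \<open>(F ^ n - x ^ n) (1 + l1 c) + c e\<close>, and \<open>l1 c \<le> - 1\<close>
  follows from \<open>l1_quadratic\<close>.\<close>

lemma below_upper_arc:
  assumes "0 \<le> x" "x \<le> F" "0 \<le> e"
  shows "h t - \<gamma> * (upper x + e) - x ^ (2 * p) + l1 * (2 * real p * x ^ (2 * p - 1)) * (upper x + e) \<le> 0"
proof -
  define c where "c = l1 * (2 * real p * x ^ (2 * p - 1)) - \<gamma>"
  have "x ^ (2 * p - 1) \<le> F ^ (2 * p - 1)" using assms by (intro power_mono) auto
  hence "l1 * (2 * real p * x ^ (2 * p - 1)) \<le> l1 * (2 * real p * F ^ (2 * p - 1))"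
    using l1_pos by (intro mult_left_mono) auto
  hence "c \<le> 2 * real p * F ^ (2 * p - 1) * l1 - \<gamma>" by (simp add: c_def mult_ac)
  hence lc: "l1 * c \<le> - 1" using l1_pos mult_left_mono[of c _ l1] by (metis l1_quadratic less_imp_le)
  hence "c \<le> 0" using l1_pos by (smt (verit) mult_nonneg_nonneg)
  have "x ^ (2 * p) \<le> F ^ (2 * p)" using assms by (intro power_mono) auto
  hence "(F ^ (2 * p) - x ^ (2 * p)) * (1 + l1 * c) \<le> 0"
    using lc by (intro mult_nonneg_nonpos) auto
  moreover have "c * e \<le> 0" using \<open>c \<le> 0\<close> assms by (simp add: mult_le_0_iff)
  moreover have "upper x * c = (F ^ (2 * p) - x ^ (2 * p)) * (l1 * c)"
    using assms by (simp add: upper_def)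
  ultimately have "h t - x ^ (2 * p) + upper x * c + c * e \<le> 0"
    using h_le[of t] unfolding distrib_left mult_1_right by linarith
  thus ?thesis by (simp add: c_def algebra_simps)
qed

definition K_upper where
  "K_upper = (l1 * (2 * real p * (F + f) ^ (2 * p - 1)) + 1) * (l1 * (2 * real p * (F + f) ^ (2 * p - 1)) + \<gamma>)"

text \<open>For \<open>x \<le> F\<close> the rate is not even positive. Only in the strip \<open>F \<le> x \<le> F + e\<close> may it be positive,
  and there \<open>upper x\<close> is negative, of the order of \<open>e\<close>.\<close>

lemma upper_rate:
  assumes "x \<le> F + e" "0 < e" "e \<le> f"
  shows "h t - \<gamma> * (upper x + e) - x ^ (2 * p) + l1 * (2 * real p * max x 0 ^ (2 * p - 1)) * (upper x + e)
    \<le> K_upper * e"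
proof -
  define c where "c = l1 * (2 * real p * (F + f) ^ (2 * p - 1))"
  have c: "c \<ge> 0" using l1_pos F f by (simp add: c_def)
  have K: "K_upper = (c + 1) * (c + \<gamma>)" by (simp add: K_upper_def c_def)
  have "K_upper * e \<ge> 0" using c \<gamma> assms by (simp add: K)
  consider "x \<le> 0" | "0 \<le> x" "x \<le> F" | "F \<le> x" by linarith
  then show ?thesis
  proof cases
    case 1
    have "F ^ (2 * p) \<le> \<gamma> * l1 * F ^ (2 * p)"
      using l1_\<gamma> F by simp
    hence "F ^ (2 * p) \<le> \<gamma> * (l1 * F ^ (2 * p))" by (simp only: mult.assoc)
    moreover have u: "upper x = l1 * F ^ (2 * p)" and m: "max x 0 ^ (2 * p - 1) = 0"
      using 1 p by (simp_all add: upper_def max_def power_0_left)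
    moreover have "\<gamma> * e \<ge> 0" "x ^ (2 * p) \<ge> 0" using \<gamma> assms by simp_all
    ultimately show ?thesis
      unfolding u m distrib_left mult_zero_left mult_zero_right
      using h_le[of t] \<open>K_upper * e \<ge> 0\<close> by linarith
  next
    case 2
    then have "max x 0 = x" by simp
    with below_upper_arc[OF 2, of e t] assms \<open>K_upper * e \<ge> 0\<close> show ?thesis by simp
  next
    case 3
    have x: "max x 0 = x" "x \<le> F + f" using 3 F assms by auto
    define d where "d = l1 * (2 * real p * x ^ (2 * p - 1))"
    have d: "0 \<le> d" "d \<le> c"
      using 3 F f x l1_pos unfolding d_def c_def by (auto intro!: mult_left_mono power_mono)
    have up: "upper x = l1 * (F ^ (2 * p) - x ^ (2 * p))" using x by (simp add: upper_def)
    have "F ^ (2 * p) \<le> x ^ (2 * p)" using 3 F by (intro power_mono) auto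
    hence up0: "upper x \<le> 0" using up l1_pos by (simp add: mult_le_0_iff)
    have "x ^ (2 * p) - F ^ (2 * p) \<le> 2 * real p * x ^ (2 * p - 1) * (x - F)"
      using power_diff_le_deriv[of F x "2 * p"] 3 F by simp
    hence "l1 * (x ^ (2 * p) - F ^ (2 * p)) \<le> l1 * (2 * real p * x ^ (2 * p - 1) * (x - F))"
      using l1_pos by (intro mult_left_mono) auto
    moreover have "- upper x = l1 * (x ^ (2 * p) - F ^ (2 * p))"
      by (simp add: up right_diff_distrib)
    moreover have "l1 * (2 * real p * x ^ (2 * p - 1) * (x - F)) = d * (x - F)"
      by (simp add: d_def mult.assoc)
    ultimately have "- upper x \<le> d * (x - F)" by linarith
    also have "\<dots> \<le> c * e" using d c assms 3 by (intro mult_mono) auto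
    finally have "\<bar>upper x + e\<bar> \<le> (c + 1) * e" using up0 assms c by (simp add: abs_le_iff algebra_simps)
    moreover have "\<bar>d - \<gamma>\<bar> \<le> c + \<gamma>" using d \<gamma> by (simp add: abs_le_iff)
    ultimately have "\<bar>(upper x + e) * (d - \<gamma>)\<bar> \<le> ((c + 1) * e) * (c + \<gamma>)"
      unfolding abs_mult using c assms by (intro mult_mono) auto
    hence "(upper x + e) * (d - \<gamma>) \<le> K_upper * e" by (simp add: K mult_ac)
    with \<open>F ^ (2 * p) \<le> x ^ (2 * p)\<close> h_le[of t] x show ?thesis
      by (simp add: d_def algebra_simps)
  qed
qed

definition K_bottom where "K_bottom = 2 * real p * (F + f) ^ (2 * p - 1)"

text \<open>Since \<open>\<bar>x\<bar> \<le> F + e\<close>, the power \<open>x ^ n\<close> exceeds \<open>F ^ n\<close> by a multiple of \<open>e\<close> at most; the rest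
  is \<open>bottom_le\<close>.\<close>

lemma bottom_rate:
  assumes "- f - e \<le> x" "x \<le> F + e" "0 < e" "e \<le> f"
  shows "- (h t - \<gamma> * (bottom - e) - x ^ (2 * p)) \<le> K_bottom * e"
proof -
  have "x ^ (2 * p) = \<bar>x\<bar> ^ (2 * p)" by (simp add: power_even_abs)
  also have "\<dots> \<le> (F + e) ^ (2 * p)"
    using assms f_le_F by (intro power_mono) auto
  also have "\<dots> \<le> F ^ (2 * p) + 2 * real p * (F + e) ^ (2 * p - 1) * e"
    using power_diff_le_deriv[of F "F + e" "2 * p"] F assms by simp
  also have "2 * real p * (F + e) ^ (2 * p - 1) * e \<le> K_bottom * e"
    unfolding K_bottom_def using assms F by (intro mult_right_mono mult_left_mono power_mono) auto
  finally have "x ^ (2 * p) \<le> F ^ (2 * p) + K_bottom * e" by simp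
  moreover have "\<gamma> * e \<ge> 0" using \<gamma> assms by simp
  ultimately show ?thesis using bottom_le h_ge[of t] by (simp add: algebra_simps)
qed

definition K_lower where
  "K_lower = 2 * real p * (2 * f) ^ (2 * p - 1) + \<gamma> * (l2 * (2 * real p * f ^ (2 * p - 1)))"

text \<open>The hypothesis \<open>bottom \<le> lower_arc x\<close> confines \<open>x\<close> to \<open>x \<le> 0\<close>, where the slope of the arc is not
  steeper than \<open>- \<gamma>\<close>, that is \<open>0 \<le> c \<le> \<gamma>\<close>. For \<open>- f \<le> x\<close> both \<open>lower_arc x\<close> and \<open>x ^ n - f ^ n\<close> are
  nonpositive; in the strip \<open>- f - e \<le> x \<le> - f\<close> they are at most of the order of \<open>e\<close>.\<close>

lemma lower_arc_rate:
  assumes "- f - e \<le> x" "0 < e" "e \<le> f" "bottom \<le> lower_arc x"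
  shows "- (l2 * (2 * real p * (x + 2 * f) ^ (2 * p - 1))) * (lower_arc x - e) -
      (h t - \<gamma> * (lower_arc x - e) - x ^ (2 * p)) \<le> K_lower * e"
proof -
  define z where "z = x + 2 * f"
  define c where "c = \<gamma> - l2 * (2 * real p * z ^ (2 * p - 1))"
  have z0: "0 \<le> z" using assms by (simp add: z_def)
  have "z ^ (2 * p) \<le> (2 * f) ^ (2 * p)"
    using assms(4) l2_pos by (simp add: bottom_def lower_arc_def z_def)
  hence z2: "z \<le> 2 * f" using power_mono_iff[of z "2 * f" "2 * p"] z0 f p by simp
  have "l2 * (2 * real p * z ^ (2 * p - 1)) \<le> l2 * (2 * real p * (2 * f) ^ (2 * p - 1))"
    using z0 z2 l2_pos by (intro mult_left_mono power_mono) auto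
  hence "l2 * (2 * real p * z ^ (2 * p - 1)) \<le> \<gamma>" by (simp only: l2_\<gamma>)
  hence c: "0 \<le> c" "c \<le> \<gamma>"
    using l2_pos z0 by (simp_all add: c_def)
  have low: "lower_arc x = l2 * (f ^ (2 * p) - z ^ (2 * p))" by (simp add: lower_arc_def z_def)
  have goal: ?thesis if "(lower_arc x - e) * c + x ^ (2 * p) - f ^ (2 * p) \<le> K_lower * e"
    using that h_ge[of t] by (simp add: c_def z_def algebra_simps)
  have ce: "c * e \<ge> 0" using c assms by simp
  show ?thesis
  proof (rule goal, cases "- f \<le> x")
    case True
    have "f ^ (2 * p) \<le> z ^ (2 * p)" using True f by (intro power_mono) (auto simp: z_def)
    hence "lower_arc x * c \<le> 0" using c l2_pos by (simp add: low mult_le_0_iff)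
    moreover have "x ^ (2 * p) \<le> f ^ (2 * p)"
      using True z2 power_mono[of "\<bar>x\<bar>" f "2 * p"] by (simp add: z_def power_even_abs)
    moreover have "K_lower * e \<ge> 0" using f \<gamma> l2_pos assms by (simp add: K_lower_def)
    ultimately show "(lower_arc x - e) * c + x ^ (2 * p) - f ^ (2 * p) \<le> K_lower * e"
      using ce by (simp add: algebra_simps)
  next
    case False
    have "f ^ (2 * p) - z ^ (2 * p) \<le> 2 * real p * f ^ (2 * p - 1) * (f - z)"
      using power_diff_le_deriv[of z f "2 * p"] z0 False by (simp add: z_def)
    also have "\<dots> \<le> 2 * real p * f ^ (2 * p - 1) * e"
      using assms f by (intro mult_left_mono) (auto simp: z_def)
    finally have "lower_arc x \<le> l2 * (2 * real p * f ^ (2 * p - 1) * e)"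
      unfolding low using l2_pos by (intro mult_left_mono) auto
    hence "lower_arc x * c \<le> l2 * (2 * real p * f ^ (2 * p - 1) * e) * c"
      using c by (intro mult_right_mono)
    also have "\<dots> \<le> l2 * (2 * real p * f ^ (2 * p - 1) * e) * \<gamma>"
      using c l2_pos f assms by (intro mult_left_mono) auto
    finally have 1: "lower_arc x * c \<le> \<gamma> * (l2 * (2 * real p * f ^ (2 * p - 1))) * e"
      by (simp add: mult_ac)
    have "x ^ (2 * p) = (- x) ^ (2 * p)" by simp
    also have "\<dots> \<le> f ^ (2 * p) + 2 * real p * (- x) ^ (2 * p - 1) * (- x - f)"
      using power_diff_le_deriv[of f "- x" "2 * p"] False f by simp
    also have "2 * real p * (- x) ^ (2 * p - 1) * (- x - f) \<le> 2 * real p * (2 * f) ^ (2 * p - 1) * e"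
      using False f assms by (intro mult_mono power_mono) auto
    finally show "(lower_arc x - e) * c + x ^ (2 * p) - f ^ (2 * p) \<le> K_lower * e"
      using 1 ce by (simp add: K_lower_def algebra_simps)
  qed
qed

section \<open>Positive invariance\<close>

text \<open>The violations of the constraints enter the comparison with the threshold \<open>\<delta> = f\<close>: it keeps
  \<open>x + 2 * f \<ge> 0\<close> and \<open>lower_arc x \<ge> 0\<close> on the strip to the left of \<open>- f\<close>.\<close>

lemma region_positively_invariant: "positively_invariant h p \<gamma> region"
  unfolding positively_invariant_def
proof (intro allI impI ballI, elim conjE)
  fix a b s :: real and x y :: "real \<Rightarrow> real"
  assume "a \<le> b" and tr: "trajectory h p \<gamma> {a..b} x y" and ini: "(x a, y a) \<in> region" and s: "s \<in> {a..b}"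
  have dx: "(x has_real_derivative y t) (at t within {a..b})"
    and dy: "(y has_real_derivative (h t - \<gamma> * y t - x t ^ (2 * p))) (at t within {a..b})"
    if "t \<in> {a..b}" for t
    using tr that by (auto simp: trajectory_def)
  let ?y' = "\<lambda>t. h t - \<gamma> * y t - x t ^ (2 * p)"
  define P where "P =
    {(\<lambda>t. - f - x t, \<lambda>t. - y t),
     (\<lambda>t. x t - F, y),
     (\<lambda>t. y t - upper (x t), \<lambda>t. ?y' t + l1 * (2 * real p * max (x t) 0 ^ (2 * p - 1)) * y t),
     (\<lambda>t. bottom - y t, \<lambda>t. - ?y' t),
     (\<lambda>t. lower_arc (x t) - y t, \<lambda>t. - (l2 * (2 * real p * (x t + 2 * f) ^ (2 * p - 1))) * y t - ?y' t)}"
  define K where "K = 1 + K_upper + K_bottom + K_lower"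
  have K_nonneg: "K_upper \<ge> 0" "K_bottom \<ge> 0" "K_lower \<ge> 0"
    using l1_pos l2_pos \<gamma> f F by (simp_all add: K_upper_def K_bottom_def K_lower_def)
  have all: "\<forall>(v, v') \<in> P. v s \<le> 0"
  proof (clarify)
    fix u u' assume mem: "(u, u') \<in> P"
    show "u s \<le> 0"
    proof (rule invariance_of_smooth_constraints[OF _ _ _ f _ mem s, of K])
      show "finite P" by (simp add: P_def)
      show "v a \<le> 0" if "(v, v') \<in> P" for v v'
        using that ini by (auto simp: P_def region_def)
      show "(v has_real_derivative v' t) (at t within {a..b})" if "(v, v') \<in> P" "t \<in> {a..b}" for v v' t
        using that(1) dx[OF that(2)] dy[OF that(2)] unfolding P_def
        by (auto intro!: derivative_eq_intros DERIV_chain2[OF upper_has_derivative]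
            DERIV_chain2[OF lower_arc_has_derivative] simp: algebra_simps)
      fix v v' t
      assume v: "(v, v') \<in> P" and "t \<in> {a..b}" and pos: "0 < v t" and le: "v t \<le> f"
        and active: "\<forall>(w, w') \<in> P. w t \<le> v t"
      define e where "e = v t"
      have b: "- f - x t \<le> e" "x t - F \<le> e" "y t - upper (x t) \<le> e" "bottom - y t \<le> e" "lower_arc (x t) - y t \<le> e"
        using active by (auto simp: P_def e_def)
      have e: "0 < e" "e \<le> f" using pos le by (simp_all add: e_def)
      have Ke: "e \<le> K * e" "K_upper * e \<le> K * e" "K_bottom * e \<le> K * e" "K_lower * e \<le> K * e"
        using K_nonneg e by (simp_all add: K_def algebra_simps)
      consider "v' t = - y t" "e = - f - x t"
        | "v' t = y t" "e = x t - F"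
        | "v' t = ?y' t + l1 * (2 * real p * max (x t) 0 ^ (2 * p - 1)) * y t" "y t = upper (x t) + e"
        | "v' t = - ?y' t" "y t = bottom - e"
        | "v' t = - (l2 * (2 * real p * (x t + 2 * f) ^ (2 * p - 1))) * y t - ?y' t" "y t = lower_arc (x t) - e"
        using v by (auto simp: P_def e_def)
      hence "v' t \<le> K * e"
      proof cases
        case 1
        \<comment> \<open>The arc rises to the left of L, so \<open>lower_arc x - y \<le> e\<close> bounds the outward velocity.\<close>
        have "(f - e) ^ (2 * p) \<le> f ^ (2 * p)" using e by (intro power_mono) auto
        moreover have "x t + 2 * f = f - e" using 1 by simp
        ultimately have "lower_arc (x t) \<ge> 0"
          using l2_pos unfolding lower_arc_def by (simp only: mult_nonneg_nonneg diff_ge_0_iff_ge less_imp_le)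
        with b 1 Ke show ?thesis by simp
      next
        case 2
        \<comment> \<open>The upper edge falls below \<open>0\<close> to the right of I, so \<open>y - upper x \<le> e\<close> does the same.\<close>
        have "F ^ (2 * p) \<le> x t ^ (2 * p)" using e 2 F by (intro power_mono) auto
        hence "upper (x t) \<le> 0" using l1_pos e 2 F by (simp add: upper_def mult_le_0_iff)
        with b 2 Ke show ?thesis by simp
      next
        case 3
        with upper_rate[of "x t" e t] b e have "v' t \<le> K_upper * e" by simp
        with Ke show ?thesis by linarith
      next
        case 4
        with bottom_rate[of e "x t" t] b e have "v' t \<le> K_bottom * e" by simp
        with Ke show ?thesis by linarith
      next
        case 5
        \<comment> \<open>That \<open>bottom\<close> is violated no more than the arc gives \<open>bottom \<le> lower_arc x\<close>.\<close>
        with lower_arc_rate[of e "x t" t] b e have "v' t \<le> K_lower * e" by simp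
        with Ke show ?thesis by linarith
      qed
      thus "v' t \<le> K * v t" by (simp add: e_def)
    qed
  qed
  thus "(x s, y s) \<in> region"
    by (auto simp: P_def region_def)
qed

section \<open>Bounded solutions on the whole line\<close>

text \<open>If \<open>x \<ge> 0\<close>, the only constraints at stake are \<open>x \<le> F\<close>, \<open>y \<le> upper x\<close> and \<open>bottom \<le> y\<close>. A violation
  now is propagated to the whole past, where it forces a linear change of \<open>x\<close> or of \<open>\<gamma> x + y\<close>
  and so contradicts boundedness.\<close>

lemma bounded_nonneg_solution_in_region:
  assumes tr: "trajectory h p \<gamma> UNIV x y"
    and x0: "\<And>t. 0 \<le> x t" and xM: "\<And>t. x t \<le> M"
  shows "(x T, y T) \<in> region"
proof -
  have dx: "(x has_real_derivative y t) (at t)"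
    and dy: "(y has_real_derivative (h t - \<gamma> * y t - x t ^ (2 * p))) (at t)" for t
    using tr by (auto simp: trajectory_def)
  define u where "u t = y t - upper (x t)" for t
  define u' where "u' t = h t - \<gamma> * y t - x t ^ (2 * p) + l1 * (2 * real p * x t ^ (2 * p - 1)) * y t" for t
  have du: "(u has_real_derivative u' t) (at t)" for t
  proof -
    have "max (x t) 0 = x t" using x0[of t] by simp
    with DERIV_diff[OF dy[of t] DERIV_chain2[OF upper_has_derivative dx[of t]]] show ?thesis
      unfolding u_def u'_def by simp
  qed
  have u_sign: "u' t \<le> 0" if "x t \<le> F" "u t > 0" for t
    using below_upper_arc[OF x0[of t], of "u t" t] that by (simp add: u_def u'_def)
  have upper_nonneg: "0 \<le> upper (x t)" if "x t \<le> F" for t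
    using that x0[of t] l1_pos by (simp add: upper_def power_mono)
  have upper_F: "upper F = 0" using F by (simp add: upper_def)
  have contx: "continuous_on {a..b} x" for a b
    using dx by (auto intro!: continuous_at_imp_continuous_on DERIV_isCont)
  have below: "u t \<le> 0" if "x t < F" for t
  proof (rule ccontr)
    assume "\<not> u t \<le> 0"
    hence ut: "u t > 0" by simp
    have up: "u t \<le> y s" if "s \<le> t" "\<And>q. s \<le> q \<Longrightarrow> q \<le> t \<Longrightarrow> x q \<le> F" for s
    proof -
      have "u t \<le> u s"
        using nonincreasing_above_level[of s t u u' 0] that du u_sign ut by blast
      thus ?thesis using upper_nonneg[of s] that by (simp add: u_def)
    qed
    \<comment> \<open>While \<open>u\<close> is positive \<open>x\<close> increases, so \<open>x\<close> was smaller in the past and never met \<open>F\<close>.\<close>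
    have left: "x s < F" if "s \<le> t" for s
    proof (rule ccontr)
      assume "\<not> x s < F"
      then obtain r where r: "s \<le> r" "r < t" "- x r = - F" "\<And>q. r < q \<Longrightarrow> q \<le> t \<Longrightarrow> - F < - x q"
        using last_crossing[of s t "\<lambda>q. - x q" "- F"] \<open>s \<le> t\<close> \<open>x t < F\<close> continuous_on_minus[OF contx]
        by (metis linorder_not_le neg_le_iff_le neg_less_iff_less)
      obtain z where z: "r < z" "z < t" "x t - x r = (t - r) * y z"
        using MVT2[of r t x y] dx r by blast
      have "x q \<le> F" if "z \<le> q" "q \<le> t" for q using r(4)[of q] z that by simp
      hence "u t \<le> y z" using up[of z] z by simp
      hence "(t - r) * y z > 0" using ut r by simp
      with z r \<open>x t < F\<close> show False by simp
    qed
    show False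
      using no_uniform_slope_if_bounded_below[of x y t "u t" 0] dx up left ut x0
      by (meson less_imp_le)
  qed
  \<comment> \<open>Crossing \<open>x = F\<close> with positive velocity would violate \<open>below\<close> just before.\<close>
  have at_F: "y t \<le> 0" if "x t = F" for t
  proof (rule ccontr)
    assume "\<not> y t \<le> 0"
    hence yt: "y t > 0" by simp
    obtain d where d: "d > 0" "\<And>k. k > 0 \<Longrightarrow> k < d \<Longrightarrow> x (t - k) < x t"
      using DERIV_pos_inc_left[OF dx yt] by blast
    have "u t > 0" using yt that by (simp add: u_def upper_F)
    moreover have "isCont u t" using du by (rule DERIV_isCont)
    ultimately have "\<forall>\<^sub>F s in at t. u s > 0" by (intro order_tendstoD(1)[of u "u t"]) (auto simp: isCont_def)
    then obtain c where c: "c > 0" "\<And>s. s \<noteq> t \<Longrightarrow> dist s t < c \<Longrightarrow> u s > 0"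
      by (auto simp: eventually_at)
    define k where "k = min c d / 2"
    have k: "k > 0" "k < d" "k < c" using c(1) d(1) by (auto simp: k_def)
    have "u (t - k) > 0" using c(2)[of "t - k"] k by (simp add: dist_real_def)
    with below[of "t - k"] d(2)[of k] k that show False by simp
  qed
  have y_sign: "h t - \<gamma> * y t - x t ^ (2 * p) \<le> 0" if "F \<le> x t" "y t > 0" for t
  proof -
    have "F ^ (2 * p) \<le> x t ^ (2 * p)" using that F by (intro power_mono) auto
    moreover have "0 < \<gamma> * y t" using \<gamma> that by simp
    ultimately show ?thesis using h_le[of t] by linarith
  qed
  have right: "x t \<le> F" for t
  proof (rule ccontr)
    assume "\<not> x t \<le> F"
    hence xt: "F < x t" by simp
    show False
    proof (cases "\<exists>s\<le>t. x s \<le> F")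
      case True
      \<comment> \<open>At the last crossing \<open>y \<le> 0\<close>, and \<open>y\<close> cannot become positive while \<open>x \<ge> F\<close>.\<close>
      then obtain r where r: "r < t" "x r = F" "\<And>q. r < q \<Longrightarrow> q \<le> t \<Longrightarrow> F < x q"
        using last_crossing[OF contx _ _ xt] by metis
      obtain z where z: "r < z" "z < t" "x t - x r = (t - r) * y z"
        using MVT2[of r t x y] dx r by blast
      have "y z \<le> 0"
      proof (rule ccontr)
        assume "\<not> y z \<le> 0"
        moreover have "F \<le> x q" if "r \<le> q" "q \<le> z" for q
          using r(2) r(3)[of q] z that by (cases "q = r") auto
        ultimately have "y z \<le> y r"
          using nonincreasing_above_level[of r z y _ 0, OF _ dy] y_sign z by simp
        with at_F[OF r(2)] \<open>\<not> y z \<le> 0\<close> show False by simp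
      qed
      hence "(t - r) * y z \<le> 0" using r by (simp add: mult_nonneg_nonpos)
      with z r xt show False by simp
    next
      case False
      hence beyond: "F < x s" if "s \<le> t" for s using that by force
      have y_neg: "y s \<le> 0" if "s \<le> t" for s
      proof (rule ccontr)
        assume ys: "\<not> y s \<le> 0"
        have "y s \<le> y q" if "q \<le> s" for q
          using nonincreasing_above_level[of q s y _ 0, OF _ dy] y_sign beyond ys that \<open>s \<le> t\<close>
          by (simp add: less_imp_le)
        thus False
          using no_uniform_slope_if_bounded_below[of x y s "y s" 0] dx ys x0 by simp
      qed
      have x_ge: "x t \<le> x s" if "s \<le> t" for s
        using DERIV_nonpos_imp_nonincreasing[OF that, of x] dx y_neg by blast
      \<comment> \<open>The derivative of \<open>\<gamma> x + y\<close> is at most \<open>- d\<close> in the whole past.\<close>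
      define d where "d = x t ^ (2 * p) - F ^ (2 * p)"
      have "d > 0" using xt F p by (simp add: d_def power_strict_mono)
      moreover have "((\<lambda>s. - (\<gamma> * x s + y s)) has_real_derivative (x s ^ (2 * p) - h s)) (at s)" for s
        using dx[of s] dy[of s] by (auto intro!: derivative_eq_intros)
      moreover have "d \<le> x s ^ (2 * p) - h s" if "s \<le> t" for s
        using h_le[of s] power_mono[OF x_ge[OF that] x0[of t], of "2 * p"] by (simp add: d_def)
      moreover have "- (\<gamma> * M) \<le> - (\<gamma> * x s + y s)" if "s \<le> t" for s
        using mult_left_mono[OF xM[of s] less_imp_le[OF \<gamma>]] y_neg[OF that] by simp
      ultimately show False
        using no_uniform_slope_if_bounded_below[of "\<lambda>s. - (\<gamma> * x s + y s)"
            "\<lambda>s. x s ^ (2 * p) - h s" t d "- (\<gamma> * M)"] by blast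
    qed
  qed
  have bottom: "bottom \<le> y T"
  proof (rule ccontr)
    assume "\<not> bottom \<le> y T"
    hence yT: "- bottom < - y T" by simp
    have "- (h t - \<gamma> * y t - x t ^ (2 * p)) \<le> 0" if "- bottom < - y t" for t
    proof -
      have "\<gamma> * y t \<le> \<gamma> * bottom" using that \<gamma> by (intro mult_left_mono) auto
      moreover have "x t ^ (2 * p) \<le> F ^ (2 * p)" using right x0 by (intro power_mono) auto
      ultimately show ?thesis using bottom_le h_ge[of t] by linarith
    qed
    hence "- y T \<le> - y t" if "t \<le> T" for t
      using nonincreasing_above_level[of t T "\<lambda>t. - y t" _ "- bottom", OF _ DERIV_minus[OF dy]] yT that by simp
    moreover have "0 < - y T" using yT bottom_neg by simp
    moreover have "- M \<le> - x t" for t using xM[of t] by simp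
    ultimately show False
      using no_uniform_slope_if_bounded_below[of "\<lambda>t. - x t" "\<lambda>t. - y t" T "- y T" "- M"] DERIV_minus[OF dx]
      by blast
  qed
  have "(2 * f) ^ (2 * p) \<le> (x T + 2 * f) ^ (2 * p)"
    using x0[of T] f by (intro power_mono) auto
  hence "lower_arc (x T) \<le> bottom"
    unfolding lower_arc_def bottom_def using l2_pos by (intro mult_left_mono) auto
  moreover have "y T \<le> upper (x T)"
    using below[of T] at_F[of T] right[of T] upper_F by (cases "x T = F") (auto simp: u_def)
  ultimately show ?thesis
    using bottom right[of T] x0[of T] f by (simp add: region_def)
qed

end

theorem theorem5:
  fixes \<omega> :: "real^'d" and fc :: "int^'d \<Rightarrow> complex" and g :: "real^'d \<Rightarrow> real"
    and p :: nat and C0 \<tau> \<gamma> f F :: real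
  assumes "analytic_forcing fc g"
    and "Re (fc 0) > 0"
    and "diophantine C0 \<tau> \<omega>"
    and "p \<ge> 1"
    and "\<gamma> > 0"
    and "f > 0" and "F > 0"
    and "\<And>t. f ^ (2 * p) \<le> g (t *\<^sub>R \<omega>)"
    and "\<And>t. g (t *\<^sub>R \<omega>) \<le> F ^ (2 * p)"
    and "\<gamma>\<^sup>2 \<ge> max (8 * real p * F ^ (2 * p - 1))
                  (real p * (F ^ (2 * p) - f ^ (2 * p)) / (f * (1 - 1 / 4 ^ p)))"
  shows "positively_invariant (\<lambda>t. g (t *\<^sub>R \<omega>)) p \<gamma> (hexagon p \<gamma> f F) \<and>
    (\<forall>\<gamma>0 x0. response_family g \<omega> p (root (2 * p) (Re (fc 0))) \<gamma>0 x0 \<and> \<gamma>0 \<le> \<gamma> \<longrightarrow>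
       orbit (x0 \<gamma>) \<subseteq> hexagon p \<gamma> f F)"
proof -
  interpret bounded_forcing_oscillator "\<lambda>t. g (t *\<^sub>R \<omega>)" p \<gamma> f F
    using assms by unfold_locales auto
  show ?thesis
    unfolding region_eq_hexagon
  proof (intro conjI allI impI region_positively_invariant)
    fix \<gamma>0 :: real and x0 :: "real \<Rightarrow> real \<Rightarrow> real"
    define c0 where "c0 = root (2 * p) (Re (fc 0))"
    assume "response_family g \<omega> p (root (2 * p) (Re (fc 0))) \<gamma>0 x0 \<and> \<gamma>0 \<le> \<gamma>"
    then obtain B where \<gamma>0: "0 < \<gamma>0" "\<gamma>0 \<le> \<gamma>" and B: "B / \<gamma>0 < c0"
      and near: "\<And>t. \<bar>x0 \<gamma> t - c0\<bar> \<le> B / \<gamma>"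
      and tr: "trajectory (\<lambda>t. g (t *\<^sub>R \<omega>)) p \<gamma> UNIV (x0 \<gamma>) (deriv (x0 \<gamma>))"
      by (auto simp: response_family_def c0_def)
    \<comment> \<open>The correction stays below \<open>c0\<close>, so \<open>x0 \<gamma>\<close> has values in \<open>{0..2 * c0}\<close>.\<close>
    have "0 \<le> B / \<gamma>" using near[of 0] by linarith
    hence "0 \<le> B" using \<open>\<gamma> > 0\<close> by (simp add: zero_le_divide_iff)
    hence "B / \<gamma> \<le> B / \<gamma>0" using \<gamma>0 by (simp add: divide_left_mono)
    hence "0 \<le> x0 \<gamma> t" "x0 \<gamma> t \<le> 2 * c0" for t
      using near[of t] B by (simp_all add: abs_le_iff)
    from bounded_nonneg_solution_in_region[OF tr this]
    show "orbit (x0 \<gamma>) \<subseteq> region" by (auto simp: orbit_def)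
  qed
qed

end
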